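(* Let $1<p<\infty$. Let $\Omega\subset\mathbb{R}^d$ be a regular domain with boundary decomposition $\partial\Omega=\partial\Omega_D\cup\partial\Omega_N$ such that, for some coordinate index $i$, $\partial\Omega_N$ is the graph of a function on a subset of the hyperplane $\{\mathbf{x}: x_i=0\}$, with $\nu\cdot\mathbf{e}_i\le 0$ a.e. on $\partial\Omega_N$. Let $L:=\sup\{x_i:\mathbf{x}\in\Omega\}-\inf\{x_i:\mathbf{x}\in\Omega\}$. Then $$\lambda_1(\Omega,\partial\Omega_D,p)\ \ge\ \frac{\mu_{I,p}}{L^p}.$$
   Context: $\Omega$ is a bounded domain in $\mathbb{R}^d$ whose boundary consists of two pieces, $\partial\Omega_D$ and $\partial\Omega_N:=\partial\Omega\setminus\partial\Omega_D$, each of positive $(d-1)$-dimensional surface measure. $\Omega$ is called regular if its boundary is of class $C$ (locally, in suitable Cartesian coordinates, $\partial\Omega$ is the graph of a continuous function with $\Omega$ lying on one side of it) and is $C^1$ a.e. with respect to surface measure. The outward unit normal $\nu$ exists a.e. on $\partial\Omega_N$. Standing assumption: the boundary is sufficiently regular that Green's formula (the Gauss–Green/divergence theorem) is valid on $\Omega$ for the test functions considered. Test functions: $\mathcal{D}(\Omega,\partial\Omega_D)$ is the set of restrictions to $\Omega$ of (real-valued) functions in $C_c^\infty(\mathbb{R}^d\setminus\partial\Omega_D)$; no boundary condition is imposed on $\partial\Omega_N$. The fundamental eigenvalue of the $p$-Laplacian with respect to $\Omega,\partial\Omega_D$ is $$\lambda_1(\Omega,\partial\Omega_D,p):=\inf\left\{\frac{\int_\Omega|\nabla\zeta|^p\,dx}{\int_\Omega|\zeta|^p\,dx}:\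 \zeta\in\mathcal{D}(\Omega,\partial\Omega_D),\ \zeta\not\equiv 0\right\}.$$ $\mathbf{e}_i$ is the $i$-th standard basis vector. $\mu_{I,p}$ is the fundamental (lowest) eigenvalue of the one-dimensional $p$-Laplacian $f\mapsto -(|f'|^{p-2}f')'$ on the unit interval with a Dirichlet condition at one end and a Neumann condition at the other, i.e. the infimum of $\int_0^1|f'|^p/\int_0^1|f|^p$ over nonzero smooth $f$ on $[0,1]$ vanishing at one fixed end (so $\mu_{I,2}=\pi^2/4$). *)

theory Defs
  imports "HOL-Analysis.Analysis"
begin

section \<open>Surface measure\<close>

definition hausdorff_gauge :: "nat \<Rightarrow> 'a::metric_space set \<Rightarrow> ennreal" where
  "hausdorff_gauge k S =
     (if S = {} then 0 else ennreal (unit_ball_vol (real k) * (diameter S / 2) ^ k))"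

definition hausdorff_premeasure :: "nat \<Rightarrow> real \<Rightarrow> 'a::metric_space set \<Rightarrow> ennreal" where
  "hausdorff_premeasure k \<delta> A =
     (INF C\<in>{C :: nat \<Rightarrow> 'a set. A \<subseteq> (\<Union>n. C n) \<and> (\<forall>n. bounded (C n) \<and> diameter (C n) \<le> \<delta>)}.
        \<Sum>n. hausdorff_gauge k (C n))"

definition hausdorff_outer :: "nat \<Rightarrow> 'a::metric_space set \<Rightarrow> ennreal" where
  "hausdorff_outer k A = (SUP \<delta>\<in>{0<..}. hausdorff_premeasure k \<delta> A)"

text \<open>
  The constant in the gauge normalises the \<open>k\<close>-dimensional Hausdorff measure so that it agrees
  with Lebesgue measure on \<open>k\<close>-dimensional subspaces. The measure lives on the
  Caratheodory-measurable sets, so it is complete: every set of outer measure zero is a null set.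
\<close>

definition hausdorff_measure :: "nat \<Rightarrow> 'a::metric_space measure" where
  "hausdorff_measure k =
     measure_of UNIV (lambda_system UNIV UNIV (hausdorff_outer k)) (hausdorff_outer k)"

lemma hausdorff_premeasure_subadditive:
  fixes A :: "nat \<Rightarrow> 'a::metric_space set"
  shows "hausdorff_premeasure k \<delta> (\<Union>i. A i) \<le> (\<Sum>i. hausdorff_premeasure k \<delta> (A i))"
proof (rule ennreal_le_epsilon)
  let ?O = "hausdorff_premeasure k \<delta> :: 'a set \<Rightarrow> ennreal"
  fix e :: real assume fin: "(\<Sum>n. ?O (A n)) < top" and e: "0 < e"
  have lt: "?O (A n) < ?O (A n) + e * (1/2) ^ Suc n" for n
  proof -
    have "?O (A n) < top"
      using ennreal_suminf_lessD[OF fin] .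
    then show ?thesis
      using e by (cases "?O (A n)") (auto simp flip: ennreal_plus simp: ennreal_less_iff)
  qed
  have "\<exists>C. A n \<subseteq> (\<Union>m. C m) \<and> (\<forall>m. bounded (C m) \<and> diameter (C m) \<le> \<delta>) \<and>
      (\<Sum>m. hausdorff_gauge k (C m)) \<le> ?O (A n) + e * (1/2) ^ Suc n" for n
  proof -
    obtain C where "C \<in> {C :: nat \<Rightarrow> 'a set. A n \<subseteq> (\<Union>m. C m) \<and> (\<forall>m. bounded (C m) \<and> diameter (C m) \<le> \<delta>)}"
      "(\<Sum>m. hausdorff_gauge k (C m)) < ?O (A n) + e * (1/2) ^ Suc n"
      using lt[of n] unfolding hausdorff_premeasure_def[of k \<delta> "A n"] INF_less_iff by blast
    then show ?thesis by (intro exI[of _ C]) auto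
  qed
  then obtain C where C: "\<And>n. A n \<subseteq> (\<Union>m. C n m)"
      "\<And>n m. bounded (C n m)" "\<And>n m. diameter (C n m) \<le> \<delta>"
      "\<And>n. (\<Sum>m. hausdorff_gauge k (C n m)) \<le> ?O (A n) + e * (1/2) ^ Suc n"
    by metis
  define B where "B = (\<lambda>j. case prod_decode j of (n, m) \<Rightarrow> C n m)"
  have cov: "(\<Union>i. A i) \<subseteq> (\<Union>j. B j)"
  proof
    fix x assume "x \<in> (\<Union>i. A i)"
    then obtain n m where "x \<in> C n m" using C(1) by blast
    then have "x \<in> B (prod_encode (n, m))" by (simp add: B_def)
    then show "x \<in> (\<Union>j. B j)" by blast
  qed
  have "?O (\<Union>i. A i) \<le> (\<Sum>j. hausdorff_gauge k (B j))"
    unfolding hausdorff_premeasure_def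
    by (rule INF_lower) (use cov C in \<open>auto simp: B_def split: prod.splits\<close>)
  also have "\<dots> = (\<Sum>n. \<Sum>m. hausdorff_gauge k (C n m))"
    using suminf_ennreal_2dimen[of "\<lambda>n. \<Sum>m. hausdorff_gauge k (C n m)" "\<lambda>(n, m). hausdorff_gauge k (C n m)"]
    by (simp add: B_def comp_def prod.case_distrib)
  also have "\<dots> \<le> (\<Sum>n. ?O (A n) + e * (1/2) ^ Suc n)"
    by (intro suminf_le C) auto
  also have "\<dots> = (\<Sum>n. ?O (A n)) + (\<Sum>n. ennreal e * ennreal ((1/2) ^ Suc n))"
    using e by (subst suminf_add[symmetric])
       (auto simp del: ennreal_suminf_cmult simp add: ennreal_mult[symmetric])
  also have "\<dots> = (\<Sum>n. ?O (A n)) + e"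
    unfolding ennreal_suminf_cmult
    by (subst suminf_ennreal_eq[OF zero_le_power power_half_series]) auto
  finally show "?O (\<Union>i. A i) \<le> (\<Sum>n. ?O (A n)) + e" .
qed

lemma outer_measure_space_hausdorff_outer:
  "outer_measure_space UNIV (hausdorff_outer k :: 'a::metric_space set \<Rightarrow> ennreal)"
  unfolding outer_measure_space_def
proof (intro conjI)
  have "hausdorff_premeasure k \<delta> ({} :: 'a set) = 0" if "0 < \<delta>" for \<delta>
    unfolding hausdorff_premeasure_def
    by (rule antisym, rule INF_lower2[of "\<lambda>_. {}"]) (use that in \<open>auto simp: hausdorff_gauge_def\<close>)
  then show "positive UNIV (hausdorff_outer k :: 'a set \<Rightarrow> ennreal)"
    by (auto simp: positive_def hausdorff_outer_def intro!: antisym SUP_least)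
  have mono: "hausdorff_premeasure k \<delta> A \<le> hausdorff_premeasure k \<delta> B" if "A \<subseteq> B" for A B :: "'a set" and \<delta>
    unfolding hausdorff_premeasure_def by (rule INF_superset_mono) (use that in auto)
  then show "increasing UNIV (hausdorff_outer k :: 'a set \<Rightarrow> ennreal)"
    unfolding increasing_def hausdorff_outer_def by (auto intro!: SUP_mono)
  show "countably_subadditive UNIV (hausdorff_outer k :: 'a set \<Rightarrow> ennreal)"
    unfolding countably_subadditive_def
  proof (intro allI impI)
    fix A :: "nat \<Rightarrow> 'a set"
    have "hausdorff_premeasure k \<delta> (\<Union>i. A i) \<le> (\<Sum>i. hausdorff_outer k (A i))" if "0 < \<delta>" for \<delta>
    proof -
      note hausdorff_premeasure_subadditive
      also have "(\<Sum>i. hausdorff_premeasure k \<delta> (A i)) \<le> (\<Sum>i. hausdorff_outer k (A i))"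
        unfolding hausdorff_outer_def by (intro suminf_le SUP_upper) (use that in auto)
      finally show ?thesis .
    qed
    then show "hausdorff_outer k (\<Union>i. A i) \<le> (\<Sum>i. hausdorff_outer k (A i))"
      unfolding hausdorff_outer_def[of k "\<Union>i. A i"] by (auto intro!: SUP_least)
  qed
qed

lemma measure_space_hausdorff:
  "measure_space UNIV (lambda_system UNIV UNIV (hausdorff_outer k))
     (hausdorff_outer k :: 'a::metric_space set \<Rightarrow> ennreal)"
  using sigma_algebra.caratheodory_lemma[OF sigma_algebra_Pow, of UNIV "hausdorff_outer k :: 'a set \<Rightarrow> ennreal"]
    outer_measure_space_hausdorff_outer[of k, where 'a='a]
  by simp

lemma sets_hausdorff_measure:
  "sets (hausdorff_measure k :: 'a::metric_space measure) = lambda_system UNIV UNIV (hausdorff_outer k)"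
  using measure_space_hausdorff[of k, where 'a='a]
  unfolding hausdorff_measure_def measure_space_def
  by (simp add: sigma_algebra.sigma_sets_eq)

lemma emeasure_hausdorff_measure:
  assumes "A \<in> sets (hausdorff_measure k :: 'a::metric_space measure)"
  shows "emeasure (hausdorff_measure k) A = hausdorff_outer k A"
  using measure_space_hausdorff[of k, where 'a='a] assms
  unfolding sets_hausdorff_measure unfolding hausdorff_measure_def measure_space_def
  by (intro emeasure_measure_of_sigma) auto

abbreviation surface_measure :: "(real ^ 'n) measure" where
  "surface_measure \<equiv> hausdorff_measure (CARD('n) - 1)"


section \<open>Smooth functions and test functions\<close>

definition grad :: "(real ^ 'n \<Rightarrow> real) \<Rightarrow> real ^ 'n \<Rightarrow> real ^ 'n" where
  "grad f x = (\<chi> j. frechet_derivative f (at x) (axis j 1))"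

primrec C_k :: "nat \<Rightarrow> (real ^ 'n \<Rightarrow> real) \<Rightarrow> bool" where
  "C_k 0 f \<longleftrightarrow> continuous_on UNIV f"
| "C_k (Suc k) f \<longleftrightarrow> f differentiable_on UNIV \<and> (\<forall>j. C_k k (\<lambda>x. grad f x $ j))"

definition C_infinity :: "(real ^ 'n \<Rightarrow> real) \<Rightarrow> bool" where
  "C_infinity f \<longleftrightarrow> (\<forall>k. C_k k f)"

text \<open>
  The space \<open>\<D>(\<Omega>, D)\<close> consists of the restrictions to \<open>\<Omega>\<close> of the functions below. Since
  \<open>\<Omega>\<close> is open, everything computed from a test function on \<open>\<Omega>\<close> depends on the restriction
  only, so the functions themselves are used as representatives.
\<close>

definition test_functions :: "(real ^ 'n) set \<Rightarrow> (real ^ 'n \<Rightarrow> real) set" where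
  "test_functions D =
     {\<zeta>. C_infinity \<zeta> \<and> compact (closure {x. \<zeta> x \<noteq> 0}) \<and> closure {x. \<zeta> x \<noteq> 0} \<subseteq> - D}"


section \<open>Regular domains\<close>

definition bounded_domain :: "(real ^ 'n) set \<Rightarrow> bool" where
  "bounded_domain \<Omega> \<longleftrightarrow> open \<Omega> \<and> connected \<Omega> \<and> \<Omega> \<noteq> {} \<and> bounded \<Omega>"

text \<open>
  In Cartesian coordinates whose last axis points in the direction \<open>u\<close>, a function of the first
  \<open>d - 1\<close> coordinates is a function on the whole space that is invariant under translations
  along \<open>u\<close>.
\<close>

definition boundary_chart ::
  "(real ^ 'n) set \<Rightarrow> real ^ 'n \<Rightarrow> (real ^ 'n) set \<Rightarrow> (real ^ 'n \<Rightarrow> real) \<Rightarrow> bool" where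
  "boundary_chart \<Omega> u U h \<longleftrightarrow>
     norm u = 1 \<and> open U \<and> (\<forall>y t. h (y + t *\<^sub>R u) = h y) \<and>
     \<Omega> \<inter> U = {y \<in> U. y \<bullet> u < h y} \<and>
     frontier \<Omega> \<inter> U = {y \<in> U. y \<bullet> u = h y}"

definition C0_boundary :: "(real ^ 'n) set \<Rightarrow> bool" where
  "C0_boundary \<Omega> \<longleftrightarrow>
     (\<forall>x\<in>frontier \<Omega>. \<exists>u U h. x \<in> U \<and> boundary_chart \<Omega> u U h \<and> continuous_on U h)"

definition C1_boundary_chart ::
  "(real ^ 'n) set \<Rightarrow> real ^ 'n \<Rightarrow> (real ^ 'n) set \<Rightarrow> (real ^ 'n \<Rightarrow> real) \<Rightarrow> bool" where
  "C1_boundary_chart \<Omega> u U h \<longleftrightarrow>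
     boundary_chart \<Omega> u U h \<and> h differentiable_on U \<and> continuous_on U (grad h)"

definition C1_boundary_point :: "(real ^ 'n) set \<Rightarrow> real ^ 'n \<Rightarrow> bool" where
  "C1_boundary_point \<Omega> x \<longleftrightarrow>
     x \<in> frontier \<Omega> \<and> (\<exists>u U h. x \<in> U \<and> C1_boundary_chart \<Omega> u U h)"

definition regular_domain :: "(real ^ 'n) set \<Rightarrow> bool" where
  "regular_domain \<Omega> \<longleftrightarrow>
     C0_boundary \<Omega> \<and> (AE x in surface_measure. x \<in> frontier \<Omega> \<longrightarrow> C1_boundary_point \<Omega> x)"

text \<open>
  Near a \<open>C\<^sup>1\<close> boundary point, \<open>\<Omega>\<close> is the set where \<open>y \<bullet> u - h y < 0\<close>, so the outward unit
  normal is the normalised gradient of that function; it does not depend on the chart. Off the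
  \<open>C\<^sup>1\<close> boundary points the value is an unspecified constant.
\<close>

definition outward_normal :: "(real ^ 'n) set \<Rightarrow> real ^ 'n \<Rightarrow> real ^ 'n" where
  "outward_normal \<Omega> x =
     (SOME \<nu>. x \<in> frontier \<Omega> \<and>
        (\<exists>u U h. x \<in> U \<and> C1_boundary_chart \<Omega> u U h \<and>
                 \<nu> = (u - grad h x) /\<^sub>R norm (u - grad h x)))"

text \<open>
  The divergence theorem for vector fields whose components are test functions. These vanish on
  \<open>D\<close>, so the boundary integral only sees \<open>frontier \<Omega> - D\<close>.
\<close>

definition green_formula_valid :: "(real ^ 'n) set \<Rightarrow> (real ^ 'n) set \<Rightarrow> bool" where
  "green_formula_valid \<Omega> D \<longleftrightarrow>
     (\<forall>F :: real ^ 'n \<Rightarrow> real ^ 'n. (\<forall>j. (\<lambda>x. F x $ j) \<in> test_functions D) \<longrightarrow>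
        set_integrable surface_measure (frontier \<Omega>) (\<lambda>x. F x \<bullet> outward_normal \<Omega> x) \<and>
        (LINT x:\<Omega>|lborel. (\<Sum>j\<in>UNIV. grad (\<lambda>y. F y $ j) x $ j)) =
        (LINT x:frontier \<Omega>|surface_measure. F x \<bullet> outward_normal \<Omega> x))"

definition width_along :: "'n \<Rightarrow> (real ^ 'n) set \<Rightarrow> real" where
  "width_along i \<Omega> = (SUP x\<in>\<Omega>. x $ i) - (INF x\<in>\<Omega>. x $ i)"


section \<open>Fundamental eigenvalues\<close>

definition fundamental_eigenvalue ::
  "(real ^ 'n) set \<Rightarrow> (real ^ 'n) set \<Rightarrow> real \<Rightarrow> ereal" where
  "fundamental_eigenvalue \<Omega> D p =
     (INF \<zeta>\<in>{\<zeta> \<in> test_functions D. \<exists>x\<in>\<Omega>. \<zeta> x \<noteq> 0}.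
        ereal ((LINT x:\<Omega>|lborel. norm (grad \<zeta> x) powr p) /
               (LINT x:\<Omega>|lborel. \<bar>\<zeta> x\<bar> powr p)))"

definition C_infinity_unit_interval :: "(real \<Rightarrow> real) \<Rightarrow> bool" where
  "C_infinity_unit_interval f \<longleftrightarrow>
     (\<exists>F :: nat \<Rightarrow> real \<Rightarrow> real. F 0 = f \<and>
        (\<forall>k. \<forall>t\<in>{0..1}. (F k has_real_derivative F (Suc k) t) (at t within {0..1})))"

definition interval_eigenvalue :: "real \<Rightarrow> ereal" where
  "interval_eigenvalue p =
     (INF f\<in>{f. C_infinity_unit_interval f \<and> f 0 = 0 \<and> (\<exists>t\<in>{0..1}. f t \<noteq> 0)}.
        ereal ((LINT t:{0..1}|lborel. \<bar>vector_derivative f (at t within {0..1})\<bar> powr p) /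
               (LINT t:{0..1}|lborel. \<bar>f t\<bar> powr p)))"

end

theory Submission
  imports Defs
begin

text \<open>
  Slice \<open>\<Omega>\<close> by the lines parallel to the \<open>i\<close>-th axis. The two ends of a component of a slice lie
  on the boundary, and since the Neumann part is a graph over \<open>x\<^sub>i = 0\<close>, at most one of them
  belongs to it. So a test function vanishes at one end at least, and after an affine change of
  variable, reversing the orientation if necessary, its restriction to the component competes for
  the interval eigenvalue. The component has length at most \<open>L\<close>; summing over the components and
  integrating over the lines gives the bound with \<open>\<partial>\<^sub>i\<zeta>\<close>, hence with the full gradient.
\<close>

section \<open>Tonelli along one axis, and open subsets of the line\<close>

text \<open>Tonelli's theorem with the coordinate along \<open>b\<close> integrated first. Values in
  \<open>ennreal\<close> spare any integrability check line by line.\<close>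

lemma nn_integral_mono_on_lines:
  fixes f g :: "'a::euclidean_space \<Rightarrow> ennreal"
  assumes meas: "f \<in> borel_measurable borel" "g \<in> borel_measurable borel"
    and b: "b \<in> Basis"
    and le: "\<And>z. (\<integral>\<^sup>+t. f (z + t *\<^sub>R b) \<partial>lborel) \<le> (\<integral>\<^sup>+t. g (z + t *\<^sub>R b) \<partial>lborel)"
  shows "(\<integral>\<^sup>+x. f x \<partial>lborel) \<le> (\<integral>\<^sup>+x. g x \<partial>lborel)"
proof -
  \<comment> \<open>\<open>T\<close> assembles a vector from its coordinates; \<open>lborel\<close>
    is the image of the product measure under it.\<close>
  define T :: "('a \<Rightarrow> real) \<Rightarrow> 'a" where "T x = (\<Sum>c\<in>Basis. x c *\<^sub>R c)" for x
  interpret product_sigma_finite "\<lambda>_::'a. lborel :: real measure" ..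
  have meas_T: "T \<in> borel_measurable (\<Pi>\<^sub>M c\<in>Basis. lborel)"
    unfolding T_def by measurable
  \<comment> \<open>So the inner integral runs along the line in direction \<open>b\<close> through
    \<open>T (x(b := 0))\<close>, which is the \<open>z\<close> of \<open>le\<close>.\<close>
  have T_upd: "T (x(b := t)) = T (x(b := 0)) + t *\<^sub>R b" for x t
  proof -
    have "T (x(b := t)) = t *\<^sub>R b + (\<Sum>c\<in>Basis - {b}. x c *\<^sub>R c)" for t
      unfolding T_def sum.remove[OF finite_Basis b] by (auto intro!: sum.cong)
    from this[of t] this[of 0] show ?thesis
      by simp
  qed
  have slice: "(\<integral>\<^sup>+x. h x \<partial>lborel) =
      (\<integral>\<^sup>+x. (\<integral>\<^sup>+t. h (T (x(b := 0)) + t *\<^sub>R b) \<partial>lborel) \<partial>(\<Pi>\<^sub>M c\<in>Basis - {b}. lborel))"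
    if h: "h \<in> borel_measurable borel" for h :: "'a \<Rightarrow> ennreal"
  proof -
    have ins: "insert b (Basis - {b}) = Basis"
      using b by blast
    have "(\<integral>\<^sup>+x. h x \<partial>lborel) = (\<integral>\<^sup>+x. h (T x) \<partial>(\<Pi>\<^sub>M c\<in>Basis. lborel))"
      using nn_integral_distr[OF meas_T, of h] h lborel_eq[where 'a='a]
      by (simp add: T_def[abs_def])
    also have "\<dots> = (\<integral>\<^sup>+x. (\<integral>\<^sup>+t. h (T (x(b := t))) \<partial>lborel) \<partial>(\<Pi>\<^sub>M c\<in>Basis - {b}. lborel))"
      using product_nn_integral_insert[of "Basis - {b}" b "\<lambda>x. h (T x)", unfolded ins]
        measurable_compose[OF meas_T h] by simp
    finally show ?thesis
      by (simp only: T_upd[symmetric])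
  qed
  show ?thesis
    unfolding slice[OF meas(1)] slice[OF meas(2)] by (intro nn_integral_mono le)
qed

text \<open>\<open>S\<close> is the disjoint union of its countably many components. Each is an open
  interval whose ends lie outside \<open>S\<close>, so the inequalities \<open>le\<close> add
  up.\<close>

lemma set_nn_integral_mono_on_gaps:
  fixes S :: "real set" and f g :: "real \<Rightarrow> ennreal"
  assumes S: "open S" "bounded S"
    and meas: "f \<in> borel_measurable borel" "g \<in> borel_measurable borel"
    and le: "\<And>a b. a < b \<Longrightarrow> a \<notin> S \<Longrightarrow> b \<notin> S \<Longrightarrow> {a<..<b} \<subseteq> S \<Longrightarrow>
      (\<integral>\<^sup>+t\<in>{a<..<b}. f t \<partial>lborel) \<le> (\<integral>\<^sup>+t\<in>{a<..<b}. g t \<partial>lborel)"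
  shows "(\<integral>\<^sup>+t\<in>S. f t \<partial>lborel) \<le> (\<integral>\<^sup>+t\<in>S. g t \<partial>lborel)"
proof -
  have op: "open C" if "C \<in> components S" for C
    using open_components[OF S(1) that] .
  have count: "countable (components S)"
    using pairwise_disjoint_components[of S] op
    by (intro countable_disjoint_open_subsets) (auto simp: pairwise_def disjnt_def)
  have comp: "(\<integral>\<^sup>+t\<in>C. f t \<partial>lborel) \<le> (\<integral>\<^sup>+t\<in>C. g t \<partial>lborel)" if C: "C \<in> components S" for C
  proof -
    have "C \<noteq> {}" "C \<subseteq> S" "connected C"
      using C in_components_nonempty in_components_subset in_components_connected by blast+
    define a b where "a = Inf C" and "b = Sup C"
    have bdd: "bdd_below C" "bdd_above C"
      using bounded_subset[OF S(2) \<open>C \<subseteq> S\<close>]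
      by (simp_all add: bounded_imp_bdd_below bounded_imp_bdd_above)
    \<comment> \<open>The shift by 1 gives the strict bounds under which an open set is known to
      miss its infimum and supremum.\<close>
    have "\<forall>x\<in>C. a - 1 < x" "\<forall>x\<in>C. x < b + 1"
      unfolding a_def b_def using bdd by (auto dest: cInf_lower cSup_upper)
    then have ends: "a \<notin> C" "b \<notin> C"
      unfolding a_def b_def using op[OF C] by (auto dest: Inf_notin_open Sup_notin_open)
    have sub: "C \<subseteq> {a<..<b}"
    proof
      fix x assume x: "x \<in> C"
      have "a \<le> x" "x \<le> b"
        unfolding a_def b_def using x bdd by (auto intro: cInf_lower cSup_upper)
      then show "x \<in> {a<..<b}"
        using ends x by (cases "x = a"; cases "x = b") auto
    qed
    have "{a<..<b} \<subseteq> C"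
    proof
      fix x assume x: "x \<in> {a<..<b}"
      obtain y z where "y \<in> C" "y < x" "z \<in> C" "x < z"
        using x \<open>C \<noteq> {}\<close> bdd unfolding a_def b_def
        by (metis cInf_less_iff less_cSup_iff greaterThanLessThan_iff)
      then show "x \<in> C"
        using \<open>connected C\<close> unfolding connected_iff_interval by (meson less_imp_le)
    qed
    with sub have C_eq: "C = {a<..<b}" by blast
    have "a < b"
      using C_eq \<open>C \<noteq> {}\<close> by force
    \<comment> \<open>An end inside \<open>S\<close> could be joined to \<open>C\<close> without
      losing connectedness, against the maximality of a component.\<close>
    have "x \<notin> S" if "x \<in> {a, b}" for x
    proof
      assume "x \<in> S"
      have "connected (insert x C)"
        using \<open>connected C\<close>
      proof (rule connected_intermediate_closure)
        show "insert x C \<subseteq> closure C"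
          using that \<open>a < b\<close> unfolding C_eq by auto
      qed auto
      then have "insert x C \<subseteq> C"
        using C \<open>C \<noteq> {}\<close> \<open>C \<subseteq> S\<close> \<open>x \<in> S\<close> by (intro components_maximal[of C S]) auto
      then show False
        using that ends by auto
    qed
    then show ?thesis
      unfolding C_eq using \<open>a < b\<close> \<open>C \<subseteq> S\<close> C_eq by (intro le) auto
  qed
  \<comment> \<open>Countable additivity of the measure with density \<open>h\<close>; the sum over
    components is an integral for counting measure.\<close>
  have sum: "(\<integral>\<^sup>+t\<in>S. h t \<partial>lborel) =
      (\<integral>\<^sup>+C. (\<integral>\<^sup>+t\<in>C. h t \<partial>lborel) \<partial>count_space (components S))"
    if h: "h \<in> borel_measurable borel" for h :: "real \<Rightarrow> ennreal"
  proof -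
    have dens: "(\<integral>\<^sup>+t\<in>A. h t \<partial>lborel) = emeasure (density lborel h) A" if "open A" for A
      using that h by (subst emeasure_density) auto
    have "(\<integral>\<^sup>+t\<in>S. h t \<partial>lborel) = emeasure (density lborel h) (\<Union>C\<in>components S. C)"
      using dens[OF S(1)] by simp
    also have "\<dots> = (\<integral>\<^sup>+C. emeasure (density lborel h) C \<partial>count_space (components S))"
      using count op pairwise_disjoint_components[of S]
      by (intro emeasure_UN_countable) (auto simp: disjoint_family_on_def pairwise_def)
    also have "\<dots> = (\<integral>\<^sup>+C. (\<integral>\<^sup>+t\<in>C. h t \<partial>lborel) \<partial>count_space (components S))"
      using dens op by (intro nn_integral_cong) auto
    finally show ?thesis .
  qed
  show ?thesis
    unfolding sum[OF meas(1)] sum[OF meas(2)] by (rule nn_integral_mono) (simp add: comp)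
qed

section \<open>The interval eigenvalue on a segment of the line\<close>

text \<open>Affine substitution. \<open>closed_segment\<close> admits \<open>d < c\<close>, so
  \<open>t = 0\<close> can stand for the right end as well as the left one.\<close>

lemma set_lborel_integral_segment:
  fixes G :: "real \<Rightarrow> real" and c d :: real
  assumes "c \<noteq> d"
  shows "(LINT x:closed_segment c d|lborel. G x) = \<bar>d - c\<bar> * (LINT t:{0..1}|lborel. G (c + (d - c) * t))"
proof -
  have ind: "indicator (closed_segment c d) (c + (d - c) * t) = (indicator {0..1} t :: real)" for t
  proof -
    have "c + (d - c) * t \<in> closed_segment c d \<longleftrightarrow> t \<in> {0..1}"
    proof
      assume "c + (d - c) * t \<in> closed_segment c d"
      then obtain u where u: "0 \<le> u" "u \<le> 1" "c + (d - c) * t = (1 - u) *\<^sub>R c + u *\<^sub>R d"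
        unfolding closed_segment_def by auto
      then have "(d - c) * (t - u) = 0"
        by (simp add: algebra_simps)
      with u assms show "t \<in> {0..1}" by auto
    next
      assume "t \<in> {0..1}"
      then show "c + (d - c) * t \<in> closed_segment c d"
        unfolding closed_segment_def by (auto intro!: exI[of _ t] simp: algebra_simps)
    qed
    then show ?thesis by (simp add: indicator_def)
  qed
  show ?thesis
    unfolding set_lebesgue_integral_def
    using lborel_integral_real_affine[of "d - c" "\<lambda>x. indicator (closed_segment c d) x *\<^sub>R G x" c] assms
    by (simp add: ind)
qed

text \<open>Pulled back to the unit interval with \<open>c\<close> at 0, \<open>F 0\<close> competes
  for \<open>interval_eigenvalue\<close>. The chain rule yields the factor
  \<open>\<bar>d - c\<bar> powr p\<close>. All derivatives are supplied as a sequence because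
  \<open>C_infinity_unit_interval\<close> asks for one.\<close>

lemma segment_poincare:
  fixes F :: "nat \<Rightarrow> real \<Rightarrow> real" and c d m p :: real
  assumes der: "\<And>k t. (F k has_real_derivative F (Suc k) t) (at t)"
    and vanish: "F 0 c = 0" and "c \<noteq> d" and "0 \<le> m" and m: "ereal m \<le> interval_eigenvalue p"
  shows "m * (LINT t:closed_segment c d|lborel. \<bar>F 0 t\<bar> powr p) \<le>
    \<bar>d - c\<bar> powr p * (LINT t:closed_segment c d|lborel. \<bar>F 1 t\<bar> powr p)"
proof -
  define s where "s = d - c"
  have s: "s \<noteq> 0" using \<open>c \<noteq> d\<close> by (simp add: s_def)
  \<comment> \<open>The \<open>k\<close>-th derivative of the pulled-back function; \<open>s\<close>
    is negative when the orientation is reversed.\<close>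
  define H where "H k t = s ^ k * F k (c + s * t)" for k t
  have H_der: "(H k has_real_derivative H (Suc k) t) (at t within {0..1})" for k t
  proof -
    have "((\<lambda>t. c + s * t) has_real_derivative s) (at t)"
      by (auto intro!: derivative_eq_intros)
    from DERIV_cmult[OF DERIV_chain2[OF der this], of "s ^ k" k]
    show ?thesis
      unfolding H_def by (auto intro: has_field_derivative_at_within simp: mult_ac)
  qed
  have smooth: "C_infinity_unit_interval (H 0)"
    unfolding C_infinity_unit_interval_def using H_der by blast
  have H0: "H 0 0 = 0"
    by (simp add: H_def vanish)
  have vd: "vector_derivative (H 0) (at t within {0..1}) = s * F 1 (c + s * t)" if "t \<in> {0..1}" for t
    using H_der[of 0 t] that
    by (intro vector_derivative_within_closed_interval)
       (auto simp: has_real_derivative_iff_has_vector_derivative H_def)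
  define A B where "A = (LINT t:{0..1}|lborel. \<bar>F 1 (c + s * t)\<bar> powr p)"
    and "B = (LINT t:{0..1}|lborel. \<bar>F 0 (c + s * t)\<bar> powr p)"
  have nonneg: "0 \<le> A" "0 \<le> B"
    unfolding A_def B_def set_lebesgue_integral_def by (auto intro!: integral_nonneg_AE)
  have "(LINT t:{0..1}|lborel. \<bar>vector_derivative (H 0) (at t within {0..1})\<bar> powr p)
      = (LINT t:{0..1}|lborel. \<bar>s\<bar> powr p * \<bar>F 1 (c + s * t)\<bar> powr p)"
    by (intro set_lebesgue_integral_cong) (auto simp: vd abs_mult powr_mult)
  then have A_eq: "(LINT t:{0..1}|lborel. \<bar>vector_derivative (H 0) (at t within {0..1})\<bar> powr p)
      = \<bar>s\<bar> powr p * A"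
    by (simp add: A_def)
  have B_eq: "(LINT t:{0..1}|lborel. \<bar>H 0 t\<bar> powr p) = B"
    by (simp add: H_def B_def)
  have "m * B \<le> \<bar>s\<bar> powr p * A"
  \<comment> \<open>The quotient can be multiplied out only if \<open>B\<close> is nonzero; for
    \<open>B = 0\<close> the left side vanishes.\<close>
  proof (cases "B = 0")
    case True
    then show ?thesis using nonneg by simp
  next
    case False
    have "\<exists>t\<in>{0..1}. H 0 t \<noteq> 0"
    proof (rule ccontr)
      assume "\<not> ?thesis"
      then have "(LINT t:{0..1}|lborel. \<bar>H 0 t\<bar> powr p) = (LINT t:{0..1::real}|lborel. 0)"
        by (intro set_lebesgue_integral_cong) auto
      then show False using False B_eq by simp
    qed
    then have "interval_eigenvalue p \<le> ereal ((\<bar>s\<bar> powr p * A) / B)"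
      unfolding interval_eigenvalue_def using smooth H0
      by (intro INF_lower2[of "H 0"]) (auto simp: A_eq B_eq)
    then have "m \<le> (\<bar>s\<bar> powr p * A) / B"
      using m by (metis ereal_less_eq(3) order_trans)
    then show ?thesis
      using False nonneg by (simp add: field_simps)
  qed
  \<comment> \<open>The extra factor is the Jacobian that the substitution puts before both
    integrals.\<close>
  then have "\<bar>s\<bar> * (m * B) \<le> \<bar>s\<bar> * (\<bar>s\<bar> powr p * A)"
    by (intro mult_left_mono) auto
  then show ?thesis
    unfolding set_lborel_integral_segment[OF \<open>c \<noteq> d\<close>] s_def[symmetric] A_def[symmetric] B_def[symmetric]
    by (simp add: mult_ac)
qed

section \<open>Smooth functions and their derivatives along an axis\<close>

lemma C_infinity_differentiable:
  assumes "C_infinity f"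
  shows "f differentiable (at x)"
proof -
  have "C_k (Suc 0) f" using assms unfolding C_infinity_def by blast
  then show ?thesis by (simp add: differentiable_on_def)
qed

lemma C_infinity_continuous:
  assumes "C_infinity f"
  shows "continuous_on UNIV f"
proof -
  have "C_k 0 f" using assms unfolding C_infinity_def by blast
  then show ?thesis by simp
qed

lemma C_infinity_partial:
  assumes "C_infinity f"
  shows "C_infinity (\<lambda>x. grad f x $ j)"
  unfolding C_infinity_def
proof
  fix k
  have "C_k (Suc k) f" using assms unfolding C_infinity_def by blast
  then show "C_k k (\<lambda>x. grad f x $ j)" by simp
qed

lemma C_infinity_continuous_grad:
  fixes f :: "real ^ 'n \<Rightarrow> real"
  assumes "C_infinity f"
  shows "continuous_on UNIV (grad f)"
proof -
  have "continuous_on UNIV (\<lambda>x. \<chi> j. grad f x $ j)"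
    by (intro continuous_on_vec_lambda C_infinity_continuous C_infinity_partial assms)
  then show ?thesis by simp
qed

text \<open>Chain rule. Iterated over the partial derivatives, it provides the sequence that
  \<open>segment_poincare\<close> takes.\<close>

lemma C_infinity_line_derivative:
  fixes f :: "real ^ 'n \<Rightarrow> real"
  assumes "C_infinity f"
  shows "((\<lambda>t. f (z + t *\<^sub>R axis i 1)) has_real_derivative grad f (z + t *\<^sub>R axis i 1) $ i) (at t)"
proof -
  let ?x = "z + t *\<^sub>R axis i 1"
  have f: "(f has_derivative frechet_derivative f (at ?x)) (at ?x)"
    using C_infinity_differentiable[OF assms] frechet_derivative_works by blast
  have "((\<lambda>t. z + t *\<^sub>R axis i 1) has_derivative (\<lambda>h. h *\<^sub>R axis i 1)) (at t)"
    by (auto intro!: derivative_eq_intros)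
  from diff_chain_at[OF this f]
  have "((\<lambda>t. f (z + t *\<^sub>R axis i 1)) has_derivative
      (\<lambda>h. frechet_derivative f (at ?x) (h *\<^sub>R axis i 1))) (at t)"
    by (simp add: o_def)
  moreover have "frechet_derivative f (at ?x) (h *\<^sub>R axis i 1) = grad f ?x $ i * h" for h
    using linear_frechet_derivative[OF C_infinity_differentiable[OF assms], of ?x]
    by (simp add: grad_def linear_cmul)
  ultimately show ?thesis
    by (simp add: has_field_derivative_def)
qed

section \<open>Integrals of continuous functions over bounded open sets\<close>

lemma set_integrable_continuous_bounded:
  fixes f :: "'a::euclidean_space \<Rightarrow> real"
  assumes "open S" "bounded S" "continuous_on UNIV f"
  shows "set_integrable lborel S f"
proof (rule set_integrable_subset)
  show "set_integrable lborel (closure S) f"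
    unfolding set_integrable_def
    using assms by (intro borel_integrable_compact) (auto intro: continuous_on_subset)
qed (use assms closure_subset in auto)

text \<open>Links the \<open>ennreal\<close> integrals of the slicing argument with the real
  integrals in the eigenvalues.\<close>

lemma set_nn_integral_eq_set_lborel_integral:
  fixes f :: "'a::euclidean_space \<Rightarrow> real"
  assumes "set_integrable lborel S f" "\<And>x. 0 \<le> f x"
  shows "(\<integral>\<^sup>+x\<in>S. ennreal (f x) \<partial>lborel) = ennreal (LINT x:S|lborel. f x)"
proof -
  have "(\<integral>\<^sup>+x\<in>S. ennreal (f x) \<partial>lborel) = (\<integral>\<^sup>+x. ennreal (indicator S x *\<^sub>R f x) \<partial>lborel)"
    by (intro nn_integral_cong) (auto simp: indicator_def)
  also have "\<dots> = ennreal (LINT x:S|lborel. f x)"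
    unfolding set_lebesgue_integral_def
    using assms by (intro nn_integral_eq_integral) (auto simp: set_integrable_def)
  finally show ?thesis .
qed

text \<open>Otherwise the part of \<open>S\<close> where \<open>f\<close> is nonzero would be a
  nonempty open null set. This makes the denominator of the Rayleigh quotient positive.\<close>

lemma set_lborel_integral_pos:
  fixes f :: "'a::euclidean_space \<Rightarrow> real"
  assumes S: "open S" "bounded S" and f: "continuous_on UNIV f" "\<And>x. 0 \<le> f x"
    and "x \<in> S" "f x \<noteq> 0"
  shows "0 < (LINT x:S|lborel. f x)"
proof (rule ccontr)
  assume "\<not> ?thesis"
  then have "(\<integral>\<^sup>+x\<in>S. ennreal (f x) \<partial>lborel) = 0"
    using set_nn_integral_eq_set_lborel_integral[OF set_integrable_continuous_bounded[OF S f(1)] f(2)]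
    by (simp add: ennreal_neg)
  then have "emeasure lborel {x \<in> space lborel. ennreal (f x) * indicator S x \<noteq> 0} = 0"
    using S borel_measurable_continuous_onI[OF f(1)] by (subst (asm) nn_integral_0_iff) auto
  moreover have "{x \<in> space lborel. ennreal (f x) * indicator S x \<noteq> 0} = S \<inter> {x. f x \<noteq> 0}"
    using f(2) by (auto simp: indicator_def ennreal_eq_0_iff order_antisym)
  moreover have op: "open (S \<inter> {x. f x \<noteq> 0})"
    using S f(1) by (intro open_Int open_Collect_neq) auto
  ultimately have "S \<inter> {x. f x \<noteq> 0} \<in> null_sets lborel"
    by (intro null_setsI) auto
  then have "negligible (S \<inter> {x. f x \<noteq> 0})"
    by (simp add: negligible_iff_null_sets null_sets_completionI)
  then show False
    using open_not_negligible[OF op] assms by blast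
qed

section \<open>The Poincare inequality in the direction of one axis\<close>

lemma diff_le_width_along:
  fixes \<Omega> :: "(real ^ 'n) set"
  assumes "bounded \<Omega>" "x \<in> \<Omega>" "y \<in> \<Omega>"
  shows "y $ i - x $ i \<le> width_along i \<Omega>"
proof -
  have "bounded ((\<lambda>x. x $ i) ` \<Omega>)"
    using assms(1) by (rule bounded_component_cart)
  then have "bdd_below ((\<lambda>x. x $ i) ` \<Omega>)" "bdd_above ((\<lambda>x. x $ i) ` \<Omega>)"
    by (simp_all add: bounded_imp_bdd_below bounded_imp_bdd_above)
  then have "(INF x\<in>\<Omega>. x $ i) \<le> x $ i" "y $ i \<le> (SUP x\<in>\<Omega>. x $ i)"
    using assms by (auto intro: cINF_lower cSUP_upper)
  then show ?thesis
    unfolding width_along_def by simp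
qed

text \<open>\<open>segment_poincare\<close> is applied on every component of every slice, starting
  from an end where \<open>\<zeta>\<close> vanishes. The product form avoids dividing by an integral
  that may be zero.\<close>

lemma poincare_along_axis:
  fixes \<Omega> D :: "(real ^ 'n) set" and i :: 'n and p m :: real
  assumes p: "0 < p" and \<Omega>: "open \<Omega>" "bounded \<Omega>"
    and graph: "S \<subseteq> {x. x $ i = 0}" "frontier \<Omega> - D = (\<lambda>x. x + g x *\<^sub>R axis i 1) ` S"
    and \<zeta>: "\<zeta> \<in> test_functions D"
    and m: "0 \<le> m" "ereal m \<le> interval_eigenvalue p"
  shows "m * (LINT x:\<Omega>|lborel. \<bar>\<zeta> x\<bar> powr p) \<le>
    width_along i \<Omega> powr p * (LINT x:\<Omega>|lborel. norm (grad \<zeta> x) powr p)"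
proof -
  define e :: "real ^ 'n" where "e = axis i 1"
  define L where "L = width_along i \<Omega>"
  \<comment> \<open>With the constants inside \<open>f\<close> and \<open>h\<close>, the claim is a
    plain comparison of two integrals, as the slicing lemmas require.\<close>
  define f where "f x = m * \<bar>\<zeta> x\<bar> powr p" for x
  define h where "h x = L powr p * norm (grad \<zeta> x) powr p" for x
  have smooth: "C_infinity \<zeta>"
    using \<zeta> unfolding test_functions_def by blast
  have zero_D: "\<zeta> x = 0" if "x \<in> D" for x
    using \<zeta> that closure_subset[of "{x. \<zeta> x \<noteq> 0}"] unfolding test_functions_def by blast
  have cont: "continuous_on UNIV f" "continuous_on UNIV h"
    unfolding f_def h_def
    using p C_infinity_continuous[OF smooth] C_infinity_continuous_grad[OF smooth]
    by (auto intro!: continuous_intros continuous_on_powr')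
  have nonneg: "0 \<le> f x" "0 \<le> h x" for x
    using m(1) by (simp_all add: f_def h_def)
  have line: "continuous_on A (\<lambda>t. z + t *\<^sub>R e)" for z A
    by (intro continuous_intros)
  have gap: "(\<integral>\<^sup>+t\<in>{a<..<b}. ennreal (f (z + t *\<^sub>R e)) \<partial>lborel) \<le>
      (\<integral>\<^sup>+t\<in>{a<..<b}. ennreal (h (z + t *\<^sub>R e)) \<partial>lborel)"
    if "a < b" and out: "z + a *\<^sub>R e \<notin> \<Omega>" "z + b *\<^sub>R e \<notin> \<Omega>"
      and ins: "\<And>t. t \<in> {a<..<b} \<Longrightarrow> z + t *\<^sub>R e \<in> \<Omega>" for a b z
  proof -
    \<comment> \<open>The ends are limits of points of the open set \<open>\<Omega>\<close> but lie
      outside it, hence they are boundary points.\<close>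
    have clos: "(\<lambda>t. z + t *\<^sub>R e) ` closure {a<..<b} \<subseteq> closure \<Omega>"
      using ins closure_subset[of \<Omega>] by (intro image_closure_subset line) auto
    have front: "z + t *\<^sub>R e \<in> frontier \<Omega>" if "t \<in> {a, b}" for t
    proof -
      have "t \<in> closure {a<..<b}"
        using that \<open>a < b\<close> by auto
      then have "z + t *\<^sub>R e \<in> closure \<Omega>"
        using clos by blast
      then show ?thesis
        using out that \<Omega>(1) by (auto simp: frontier_def interior_open)
    qed
    \<comment> \<open>Otherwise both ends lie on the graph. Their base points agree off coordinate
      \<open>i\<close>, being on one line, and in coordinate \<open>i\<close>, where both are 0; so
      the ends coincide.\<close>
    have "\<zeta> (z + a *\<^sub>R e) = 0 \<or> \<zeta> (z + b *\<^sub>R e) = 0"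
    proof (rule ccontr)
      assume "\<not> ?thesis"
      then have "z + a *\<^sub>R e \<in> frontier \<Omega> - D" "z + b *\<^sub>R e \<in> frontier \<Omega> - D"
        using front zero_D by auto
      then obtain x y where x: "x \<in> S" "z + a *\<^sub>R e = x + g x *\<^sub>R e"
        and y: "y \<in> S" "z + b *\<^sub>R e = y + g y *\<^sub>R e"
        unfolding graph(2) e_def by blast
      have "x $ j = y $ j" for j
      proof (cases "j = i")
        case True
        then show ?thesis using subsetD[OF graph(1) x(1)] subsetD[OF graph(1) y(1)] by simp
      next
        case False
        then show ?thesis
          using arg_cong[OF x(2), of "\<lambda>v. v $ j"] arg_cong[OF y(2), of "\<lambda>v. v $ j"]
          by (simp add: e_def axis_def)
      qed
      then have "x = y" by (simp add: vec_eq_iff)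
      then have "z + a *\<^sub>R e = z + b *\<^sub>R e" using x(2) y(2) by simp
      then show False using \<open>a < b\<close> by (simp add: e_def axis_eq_0_iff)
    qed
    then obtain c d where c: "\<zeta> (z + c *\<^sub>R e) = 0" and "c \<noteq> d"
      and seg: "closed_segment c d = {a..b}" and len: "\<bar>d - c\<bar> = b - a"
    proof
      assume "\<zeta> (z + a *\<^sub>R e) = 0"
      then show thesis
        using \<open>a < b\<close> by (intro that[of a b]) (auto simp: closed_segment_eq_real_ivl)
    next
      assume "\<zeta> (z + b *\<^sub>R e) = 0"
      then show thesis
        using \<open>a < b\<close> by (intro that[of b a]) (auto simp: closed_segment_eq_real_ivl)
    qed
    \<comment> \<open>\<open>diff_le_width_along\<close> compares points of \<open>\<Omega>\<close>
      only, so both ends are first moved inwards by \<open>\<delta>\<close>, at a cost of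
      \<open>2 * \<delta>\<close>, which is below \<open>\<epsilon>\<close>.\<close>
    have "b - a \<le> L"
    proof (rule field_le_epsilon)
      fix \<epsilon> :: real assume "0 < \<epsilon>"
      define \<delta> where "\<delta> = min \<epsilon> (b - a) / 3"
      have \<delta>: "0 < \<delta>" "3 * \<delta> \<le> \<epsilon>" "3 * \<delta> \<le> b - a"
        using \<open>0 < \<epsilon>\<close> \<open>a < b\<close> by (auto simp: \<delta>_def)
      have "(z + (b - \<delta>) *\<^sub>R e) $ i - (z + (a + \<delta>) *\<^sub>R e) $ i \<le> L"
        unfolding L_def using \<delta> by (intro diff_le_width_along \<Omega>(2) ins) auto
      then show "b - a \<le> L + \<epsilon>"
        using \<delta> by (simp add: e_def)
    qed
    \<comment> \<open>The \<open>k\<close>-th pure partial derivative along axis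
      \<open>i\<close>.\<close>
    define Z where "Z k = ((\<lambda>f x. grad f x $ i) ^^ k) \<zeta>" for k
    have Z_smooth: "C_infinity (Z k)" for k
      by (induction k) (auto simp: Z_def smooth intro: C_infinity_partial)
    have Z_der: "((\<lambda>t. Z k (z + t *\<^sub>R e)) has_real_derivative Z (Suc k) (z + t *\<^sub>R e)) (at t)" for k t
      using C_infinity_line_derivative[OF Z_smooth, of k z i t] by (simp add: Z_def e_def)
    have "m * (LINT t:{a..b}|lborel. \<bar>\<zeta> (z + t *\<^sub>R e)\<bar> powr p) \<le>
        (b - a) powr p * (LINT t:{a..b}|lborel. \<bar>grad \<zeta> (z + t *\<^sub>R e) $ i\<bar> powr p)"
      using segment_poincare[of "\<lambda>k t. Z k (z + t *\<^sub>R e)", OF Z_der _ \<open>c \<noteq> d\<close> m] c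
      by (simp add: seg len Z_def)
    also have "\<dots> \<le> L powr p * (LINT t:{a..b}|lborel. norm (grad \<zeta> (z + t *\<^sub>R e)) powr p)"
    proof (rule mult_mono)
      show "(b - a) powr p \<le> L powr p"
        using \<open>b - a \<le> L\<close> \<open>a < b\<close> p by (intro powr_mono2) auto
      have cont_grad: "continuous_on {a..b} (\<lambda>t. grad \<zeta> (z + t *\<^sub>R e))"
        by (rule continuous_on_compose2[OF C_infinity_continuous_grad[OF smooth] line]) auto
      show "(LINT t:{a..b}|lborel. \<bar>grad \<zeta> (z + t *\<^sub>R e) $ i\<bar> powr p) \<le>
          (LINT t:{a..b}|lborel. norm (grad \<zeta> (z + t *\<^sub>R e)) powr p)"
      proof (rule set_integral_mono)
        show "set_integrable lborel {a..b} (\<lambda>t. \<bar>grad \<zeta> (z + t *\<^sub>R e) $ i\<bar> powr p)"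
          "set_integrable lborel {a..b} (\<lambda>t. norm (grad \<zeta> (z + t *\<^sub>R e)) powr p)"
          unfolding set_integrable_def using p cont_grad
          by (intro borel_integrable_compact continuous_on_powr' continuous_intros; simp)+
        show "\<bar>grad \<zeta> (z + t *\<^sub>R e) $ i\<bar> powr p \<le> norm (grad \<zeta> (z + t *\<^sub>R e)) powr p" for t
          using p by (intro powr_mono2 component_le_norm_cart) auto
      qed
      show "0 \<le> (LINT t:{a..b}|lborel. \<bar>grad \<zeta> (z + t *\<^sub>R e) $ i\<bar> powr p)"
        unfolding set_lebesgue_integral_def by (auto intro!: integral_nonneg_AE)
    qed auto
    finally have "(LINT t:{a..b}|lborel. f (z + t *\<^sub>R e)) \<le> (LINT t:{a..b}|lborel. h (z + t *\<^sub>R e))"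
      by (simp add: f_def h_def)
    \<comment> \<open>The two ends form a null set: both set integrals equal the same interval
      integral.\<close>
    then have le: "(LINT t:{a<..<b}|lborel. f (z + t *\<^sub>R e)) \<le> (LINT t:{a<..<b}|lborel. h (z + t *\<^sub>R e))"
      using \<open>a < b\<close> interval_integral_Icc[of a b, where 'a=real] interval_integral_Ioo[of a b, where 'a=real]
      by simp
    have "set_integrable lborel {a<..<b} (\<lambda>t. u (z + t *\<^sub>R e))" if "continuous_on UNIV u" for u :: "real ^ 'n \<Rightarrow> real"
      using continuous_on_compose2[OF that line] by (intro set_integrable_continuous_bounded) auto
    then show ?thesis
      using cont nonneg le by (simp add: set_nn_integral_eq_set_lborel_integral ennreal_leI)
  qed
  have meas: "(\<lambda>x. ennreal (u x) * indicator \<Omega> x) \<in> borel_measurable borel"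
    if "continuous_on UNIV u" for u :: "real ^ 'n \<Rightarrow> real"
    using borel_measurable_continuous_onI[OF that] \<Omega>(1)
    by (intro borel_measurable_times_ennreal borel_measurable_indicator) auto
  have "(\<integral>\<^sup>+x\<in>\<Omega>. ennreal (f x) \<partial>lborel) \<le> (\<integral>\<^sup>+x\<in>\<Omega>. ennreal (h x) \<partial>lborel)"
  proof (rule nn_integral_mono_on_lines[OF meas[OF cont(1)] meas[OF cont(2)]])
    show "e \<in> Basis" by (simp add: e_def axis_in_Basis_iff)
    fix z
    \<comment> \<open>The slice of \<open>\<Omega>\<close> through \<open>z\<close>, as a set of
      parameters; its components are the intervals treated in \<open>gap\<close>.\<close>
    define T where "T = (\<lambda>t. z + t *\<^sub>R e) -` \<Omega>"
    have ind: "indicator \<Omega> (z + t *\<^sub>R e) = (indicator T t :: ennreal)" for t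
      by (simp add: T_def indicator_def)
    obtain B where B: "\<And>x. x \<in> \<Omega> \<Longrightarrow> norm x \<le> B"
      using \<Omega>(2) unfolding bounded_iff by blast
    have "\<bar>t\<bar> \<le> B + norm z" if "t \<in> T" for t
    proof -
      have "norm (t *\<^sub>R e) \<le> norm (z + t *\<^sub>R e) + norm z"
        by (metis add_diff_cancel_left' norm_triangle_ineq4)
      then show ?thesis
        using B[of "z + t *\<^sub>R e"] that by (simp add: T_def e_def)
    qed
    then have "bounded T" unfolding bounded_iff by auto
    have "open T"
      unfolding T_def using \<Omega>(1) line by (rule open_vimage)
    have comp: "(\<lambda>t. ennreal (u (z + t *\<^sub>R e))) \<in> borel_measurable borel"
      if "continuous_on UNIV u" for u :: "real ^ 'n \<Rightarrow> real"
      using borel_measurable_continuous_onI[OF continuous_on_compose2[OF that line]] by simp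
    have "(\<integral>\<^sup>+t\<in>T. ennreal (f (z + t *\<^sub>R e)) \<partial>lborel) \<le> (\<integral>\<^sup>+t\<in>T. ennreal (h (z + t *\<^sub>R e)) \<partial>lborel)"
      using \<open>open T\<close> \<open>bounded T\<close>
      by (rule set_nn_integral_mono_on_gaps[OF _ _ comp[OF cont(1)] comp[OF cont(2)]])
         (intro gap; auto simp: T_def)
    then show "(\<integral>\<^sup>+t. ennreal (f (z + t *\<^sub>R e)) * indicator \<Omega> (z + t *\<^sub>R e) \<partial>lborel) \<le>
        (\<integral>\<^sup>+t. ennreal (h (z + t *\<^sub>R e)) * indicator \<Omega> (z + t *\<^sub>R e) \<partial>lborel)"
      by (simp add: ind)
  qed
  then have "ennreal (LINT x:\<Omega>|lborel. f x) \<le> ennreal (LINT x:\<Omega>|lborel. h x)"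
    using set_integrable_continuous_bounded[OF \<Omega>] cont nonneg
    by (simp add: set_nn_integral_eq_set_lborel_integral)
  \<comment> \<open>\<open>ennreal\<close> sends negative reals to 0, so an inequality comes back to
    the reals once its right side is known to be nonnegative.\<close>
  moreover have "0 \<le> (LINT x:\<Omega>|lborel. h x)"
    unfolding set_lebesgue_integral_def using nonneg by (auto intro!: integral_nonneg_AE)
  ultimately show ?thesis
    by (simp add: f_def h_def L_def)
qed

section \<open>From the integral inequality to the eigenvalues\<close>

text \<open>The identity is a competitor with a real quotient, and no quotient is negative. So the
  infimum is finite and the estimates can be made in the reals.\<close>

lemma interval_eigenvalue_real:
  obtains m where "0 \<le> m" "interval_eigenvalue p = ereal m"
proof -
  have "C_infinity_unit_interval (\<lambda>t. t)"
    unfolding C_infinity_unit_interval_def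
    by (rule exI[of _ "\<lambda>k t. if k = 0 then t else if k = 1 then 1 else 0"]) auto
  then have "interval_eigenvalue p \<le>
      ereal ((LINT t:{0..1}|lborel. \<bar>vector_derivative (\<lambda>t. t) (at t within {0..1})\<bar> powr p) /
             (LINT t:{0..1}|lborel. \<bar>t::real\<bar> powr p))"
    unfolding interval_eigenvalue_def by (intro INF_lower) (auto intro!: bexI[of _ 1])
  then have "interval_eigenvalue p < \<infinity>"
    by (rule le_less_trans) simp
  moreover have "0 \<le> interval_eigenvalue p"
    unfolding interval_eigenvalue_def set_lebesgue_integral_def
    by (auto intro!: INF_greatest divide_nonneg_nonneg integral_nonneg_AE)
  ultimately show thesis
    using that by (cases "interval_eigenvalue p") auto
qed

theorem mainTheorem3:
  fixes \<Omega> D :: "(real ^ 'n) set" and i :: 'n and p :: real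
  assumes "1 < p"
    and "bounded_domain \<Omega>"
    and "regular_domain \<Omega>"
    and "D \<subseteq> frontier \<Omega>"
    and "0 < emeasure surface_measure D"
    and "0 < emeasure surface_measure (frontier \<Omega> - D)"
    and "green_formula_valid \<Omega> D"
    and "\<exists>S g. S \<subseteq> {x. x $ i = 0} \<and> frontier \<Omega> - D = (\<lambda>x. x + g x *\<^sub>R axis i 1) ` S"
    and "AE x in surface_measure. x \<in> frontier \<Omega> - D \<longrightarrow> outward_normal \<Omega> x \<bullet> axis i 1 \<le> 0"
  shows "fundamental_eigenvalue \<Omega> D p \<ge> interval_eigenvalue p / ereal (width_along i \<Omega> powr p)"
  unfolding fundamental_eigenvalue_def
proof (rule INF_greatest)
  fix \<zeta> assume "\<zeta> \<in> {\<zeta> \<in> test_functions D. \<exists>x\<in>\<Omega>. \<zeta> x \<noteq> 0}"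
  then obtain x where \<zeta>: "\<zeta> \<in> test_functions D" and x: "x \<in> \<Omega>" "\<zeta> x \<noteq> 0" by blast
  have \<Omega>: "open \<Omega>" "bounded \<Omega>"
    using assms(2) unfolding bounded_domain_def by auto
  obtain S g where graph: "S \<subseteq> {x. x $ i = 0}"
      "frontier \<Omega> - D = (\<lambda>x. x + g x *\<^sub>R axis i 1) ` S"
    using assms(8) by blast
  obtain m where m: "0 \<le> m" "interval_eigenvalue p = ereal m"
    by (rule interval_eigenvalue_real)
  \<comment> \<open>A step of length \<open>r / 2\<close> along the axis stays in
    \<open>\<Omega>\<close>, so the width is positive and can be divided by.\<close>
  obtain r where r: "0 < r" "ball x r \<subseteq> \<Omega>"
    using \<Omega>(1) x(1) open_contains_ball by blast
  have "x + (r / 2) *\<^sub>R axis i 1 \<in> \<Omega>"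
    using r by (intro subsetD[OF r(2)]) (simp add: dist_norm)
  from diff_le_width_along[OF \<Omega>(2) x(1) this, of i] have L: "0 < width_along i \<Omega>"
    using r(1) by simp
  have "continuous_on UNIV \<zeta>"
    using \<zeta> C_infinity_continuous unfolding test_functions_def by blast
  \<comment> \<open>Together with the positive width, this turns the product inequality into one
    between quotients.\<close>
  then have "0 < (LINT x:\<Omega>|lborel. \<bar>\<zeta> x\<bar> powr p)"
    using assms(1) x
    by (intro set_lborel_integral_pos[OF \<Omega>, of _ x]) (auto intro!: continuous_intros continuous_on_powr')
  moreover have "m * (LINT x:\<Omega>|lborel. \<bar>\<zeta> x\<bar> powr p) \<le>
      width_along i \<Omega> powr p * (LINT x:\<Omega>|lborel. norm (grad \<zeta> x) powr p)"
    using assms(1) m by (intro poincare_along_axis[OF _ \<Omega> graph \<zeta>]) auto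
  ultimately have "m / width_along i \<Omega> powr p \<le>
      (LINT x:\<Omega>|lborel. norm (grad \<zeta> x) powr p) / (LINT x:\<Omega>|lborel. \<bar>\<zeta> x\<bar> powr p)"
    using L by (simp add: field_simps)
  then show "interval_eigenvalue p / ereal (width_along i \<Omega> powr p) \<le>
      ereal ((LINT x:\<Omega>|lborel. norm (grad \<zeta> x) powr p) / (LINT x:\<Omega>|lborel. \<bar>\<zeta> x\<bar> powr p))"
    using L by (simp add: m(2))
qed

end
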